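(* For every fixed $p\in(0,1)$ and $G\sim G(n,p)$, $$\mathbb P\bigl(\chi_m(G)\le 4\bigr)\longrightarrow 1\qquad (n\to\infty).$$
   Context: $G(n,p)$ is the Erdős–Rényi random graph on $n$ labeled vertices in which each pair is an edge independently with probability $p$. For a finite simple graph $G=(V,E)$, $N_G(v)$ is the open neighborhood of $v$. Given a partition $V=P_1\cup\cdots\cup P_q$, the signature of a vertex $v$ is $\sigma(v)=\bigl(|N_G(v)\cap P_i|\bigr)_{i=1}^q$. The (ordered) partition is a multiset coloring if $\sigma(u)\ne\sigma(v)$ for every edge $uv\in E$. The multiset chromatic number $\chi_m(G)$ is the minimum number $q$ of parts in a multiset coloring of $G$. *)

theory Defs
  imports "HOL-Probability.Probability" "HOL-Library.Ramsey" "HOL-Library.Disjoint_Sets"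
begin

text \<open>
  A finite simple graph is given by a finite vertex set \<open>V\<close> and an edge set \<open>E \<subseteq> nsets V 2\<close>, the
  edges being two-element subsets of \<open>V\<close>.
\<close>

definition nbhd :: "'a set \<Rightarrow> 'a set set \<Rightarrow> 'a \<Rightarrow> 'a set" where
  "nbhd V E v = {u \<in> V. {u, v} \<in> E}"

text \<open>
  An ordered partition \<open>(P\<^sub>1, \<dots>, P\<^sub>q)\<close> is a list of length \<open>q\<close>; as usual for partitions, the
  parts are nonempty (this is included in \<^const>\<open>partition_on\<close>).
\<close>

definition ordered_partition :: "'a set \<Rightarrow> 'a set list \<Rightarrow> bool" where
  "ordered_partition V Ps \<longleftrightarrow> distinct Ps \<and> partition_on V (set Ps)"

definition signature :: "'a set \<Rightarrow> 'a set set \<Rightarrow> 'a set list \<Rightarrow> 'a \<Rightarrow> nat list" where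
  "signature V E Ps v = map (\<lambda>P. card (nbhd V E v \<inter> P)) Ps"

definition multiset_coloring :: "'a set \<Rightarrow> 'a set set \<Rightarrow> 'a set list \<Rightarrow> bool" where
  "multiset_coloring V E Ps \<longleftrightarrow>
     ordered_partition V Ps \<and>
     (\<forall>u v. {u, v} \<in> E \<longrightarrow> signature V E Ps u \<noteq> signature V E Ps v)"

definition multiset_chromatic_number :: "'a set \<Rightarrow> 'a set set \<Rightarrow> nat" where
  "multiset_chromatic_number V E = (LEAST q. \<exists>Ps. multiset_coloring V E Ps \<and> length Ps = q)"

text \<open>
  The minimum is attained for every finite simple graph, since the partition into singletons is a
  multiset coloring.
\<close>

lemma multiset_coloring_exists:
  assumes "finite V" "E \<subseteq> nsets V 2"
  shows "\<exists>Ps. multiset_coloring V E Ps"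
proof -
  obtain xs where xs: "set xs = V" "distinct xs"
    using finite_distinct_list[OF assms(1)] by blast
  define Ps where "Ps = map (\<lambda>x. {x}) xs"
  have "ordered_partition V Ps"
    using xs by (auto simp: ordered_partition_def Ps_def partition_on_def distinct_map inj_on_def
        disjoint_def)
  moreover have "signature V E Ps u \<noteq> signature V E Ps v" if e: "{u, v} \<in> E" for u v
  proof
    assume eq: "signature V E Ps u = signature V E Ps v"
    have uv: "{u, v} \<subseteq> V" "card {u, v} = 2"
      using e assms(2) by (auto simp: nsets_def)
    have no_loop: "{v, v} \<notin> E"
      using assms(2) by (auto simp: nsets_def)
    have "{v} \<in> set Ps"
      using uv xs by (auto simp: Ps_def)
    hence "card (nbhd V E u \<inter> {v}) = card (nbhd V E v \<inter> {v})"
      using eq by (auto simp: signature_def)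
    moreover have "nbhd V E u \<inter> {v} = {v}"
      using e uv by (auto simp: nbhd_def insert_commute)
    moreover have "nbhd V E v \<inter> {v} = {}"
      using no_loop by (auto simp: nbhd_def)
    ultimately show False by simp
  qed
  ultimately show ?thesis
    unfolding multiset_coloring_def by blast
qed

text \<open>
  The random graph \<open>G(n, p)\<close> on the vertex set \<open>{..<n}\<close>, as the distribution of its edge set:
  the indicators of the potential edges are independent Bernoulli variables with parameter \<open>p\<close>.
\<close>

definition gnp :: "nat \<Rightarrow> real \<Rightarrow> nat set set pmf" where
  "gnp n p =
     map_pmf (\<lambda>f. {e \<in> nsets {..<n} 2. f e})
       (Pi_pmf (nsets {..<n} 2) False (\<lambda>_. bernoulli_pmf p))"

end

theory Submission
  imports Defs
begin

text \<open>
  Fix the partition of the vertices into residue classes modulo 4. Two vertices have signatures that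
  differ by a given vector with probability \<open>O(n\<^sup>-\<^sup>2)\<close>, a factor \<open>O(1 / sqrt n)\<close> per class, so
  \<open>O(1)\<close> collisions are expected. They are repaired by moving one vertex \<open>w\<close>
  from class 0 to class 1, which adds \<open>(-1, 1, 0, 0)\<close> to the signatures of the neighbours of \<open>w\<close>
  and changes nothing else. Call two vertices near if their signatures differ by \<open>0\<close> or
  \<open>\<plusminus>(1, -1, 0, 0)\<close>; only near pairs can collide after the move. The expected number of near pairs is
  \<open>O(1)\<close>, and the expected number of triples \<open>u, v, w\<close> with \<open>u, v\<close> and \<open>w, v\<close> near is \<open>O(n\<^sup>-\<^sup>1)\<close>.
  Hence with probability close to 1 the near pairs are disjoint and bounded in number, and by the
  extension property of random graphs there is a vertex \<open>w\<close> adjacent to exactly one vertex of every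
  colliding pair and to no other vertex of a near pair.
\<close>

section \<open>Point probabilities of the binomial distribution\<close>

lemma Bernstein_Suc_mult:
  fixes x :: real
  assumes "k \<le> m"
  shows "real (Suc m) * (1 - x) * Bernstein m k x = real (Suc m - k) * Bernstein (Suc m) k x"
proof -
  have *: "real (Suc m - k) * real (Suc m choose k) = real (Suc m) * real (m choose k)"
    using binomial_absorb_comp[of "Suc m" k] by (simp only: diff_Suc_1 flip: of_nat_mult)
  have "real (Suc m - k) * Bernstein (Suc m) k x =
      (real (Suc m - k) * real (Suc m choose k)) * x ^ k * (1 - x) ^ Suc (m - k)"
    using assms by (simp add: Bernstein_def Suc_diff_le)
  also have "\<dots> = real (Suc m) * (1 - x) * Bernstein m k x"
    unfolding * by (simp add: Bernstein_def)
  finally show ?thesis by simp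
qed

lemma Bernstein_Suc_Suc_mult:
  fixes x :: real
  shows "real (Suc m) * x * Bernstein m k x = real (Suc k) * Bernstein (Suc m) (Suc k) x"
proof -
  have *: "real (Suc k) * real (Suc m choose Suc k) = real (Suc m) * real (m choose k)"
    using Suc_times_binomial[of k m] by (simp only: flip: of_nat_mult)
  have "real (Suc k) * Bernstein (Suc m) (Suc k) x =
      (real (Suc k) * real (Suc m choose Suc k)) * x ^ Suc k * (1 - x) ^ (m - k)"
    by (simp add: Bernstein_def)
  also have "\<dots> = real (Suc m) * x * Bernstein m k x"
    unfolding * by (simp add: Bernstein_def)
  finally show ?thesis by simp
qed

text \<open>By the two absorption identities above, the increment of the left side from
  \<open>k\<close> to \<open>Suc k\<close> is exactly the summand with index
  \<open>Suc k\<close>.\<close>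

lemma Bernstein_telescope:
  fixes x :: real
  assumes "k \<le> m"
  shows "real (Suc m) * x * (1 - x) * Bernstein m k x =
    (\<Sum>j\<le>k. (real (Suc m) * x - real j) * Bernstein (Suc m) j x)"
  using assms
proof (induction k)
  case 0
  then show ?case using Bernstein_Suc_mult[of 0 m x] by (simp add: mult_ac)
next
  case (Suc k)
  let ?B = "Bernstein (Suc m) (Suc k) x"
  have 1: "real (Suc m) * (1 - x) * Bernstein m (Suc k) x = (real m - real k) * ?B"
    using Bernstein_Suc_mult[of "Suc k" m x] Suc.prems by (simp add: of_nat_diff)
  have 2: "real (Suc m) * x * Bernstein m k x = real (Suc k) * ?B"
    by (rule Bernstein_Suc_Suc_mult)
  have "real (Suc m) * x * (1 - x) * Bernstein m (Suc k) x = x * ((real m - real k) * ?B)"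
    unfolding 1[symmetric] by simp
  also have "\<dots> = (1 - x) * (real (Suc k) * ?B) + (real (Suc m) * x - real (Suc k)) * ?B"
    by (simp add: algebra_simps)
  also have "(1 - x) * (real (Suc k) * ?B) = real (Suc m) * x * (1 - x) * Bernstein m k x"
    unfolding 2[symmetric] by simp
  finally show ?case using Suc by simp
qed

lemma sum_Bernstein_variance:
  fixes x :: real
  shows "(\<Sum>k\<le>n. (real n * x - real k)\<^sup>2 * Bernstein n k x) = real n * x * (1 - x)"
proof -
  \<comment> \<open>The square is expanded in the falling factorials \<open>a * (a - 1)\<close> and
    \<open>a\<close>, whose Bernstein sums are known.\<close>
  have *: "\<And>a b x::real. (b - a)\<^sup>2 * x = a * (a - 1) * x + (1 - 2 * b) * a * x + b * b * x"
    by (simp add: algebra_simps power2_eq_square)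
  show ?thesis
    apply (simp add: * sum.distrib)
    apply (simp flip: sum_distrib_left add: mult.assoc)
    apply (simp add: algebra_simps power2_eq_square)
    done
qed

text \<open>
  A binomial probability is at most the total variation of the distribution to its left, which the
  telescoping identity turns into a mean absolute deviation.
\<close>

lemma Bernstein_le:
  fixes x :: real
  assumes "0 < x" "x < 1"
  shows "Bernstein m k x \<le> 1 / sqrt (real (Suc m) * x * (1 - x))"
proof (cases "k \<le> m")
  case False
  then show ?thesis using assms by (simp add: Bernstein_def binomial_eq_0)
next
  case True
  define V where "V = real (Suc m) * x * (1 - x)"
  define s where "s = sqrt V"
  have V: "V > 0" using assms by (simp add: V_def)
  then have s: "s > 0" "s\<^sup>2 = V" by (simp_all add: s_def)
  \<comment> \<open>This replaces Cauchy-Schwarz: with \<open>s\<close> the standard deviation for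
    \<open>Suc m\<close> trials, averaging the right side gives exactly \<open>s\<close>.\<close>
  have amgm: "\<bar>a\<bar> \<le> (a\<^sup>2 / s + s) / 2" for a :: real
    using s sum_squares_bound[of "\<bar>a\<bar>" s] by (simp add: field_simps power2_eq_square)
  let ?B = "\<lambda>j. Bernstein (Suc m) j x" and ?a = "\<lambda>j. real (Suc m) * x - real j"
  have nn: "?B j \<ge> 0" for j using assms by (intro Bernstein_nonneg) auto
  have "V * Bernstein m k x = (\<Sum>j\<le>k. ?a j * ?B j)"
    unfolding V_def by (rule Bernstein_telescope[OF True])
  also have "\<dots> \<le> (\<Sum>j\<le>k. \<bar>?a j\<bar> * ?B j)"
    by (intro sum_mono mult_right_mono nn) auto
  also have "\<dots> \<le> (\<Sum>j\<le>Suc m. \<bar>?a j\<bar> * ?B j)"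
    using True nn by (intro sum_mono2) auto
  also have "\<dots> \<le> (\<Sum>j\<le>Suc m. ((?a j)\<^sup>2 / s + s) / 2 * ?B j)"
    by (intro sum_mono mult_right_mono nn amgm)
  also have "\<dots> = ((\<Sum>j\<le>Suc m. (?a j)\<^sup>2 * ?B j) / s + s * (\<Sum>j\<le>Suc m. ?B j)) / 2"
    by (simp only: sum_distrib_left sum_divide_distrib sum.distrib[symmetric])
      (auto intro!: sum.cong simp: field_simps)
  also have "\<dots> = (V / s + s) / 2"
    by (simp only: sum_Bernstein_variance sum_Bernstein V_def mult_1_right)
  also have "\<dots> = s" using s by (simp add: field_simps power2_eq_square)
  finally have "V * Bernstein m k x \<le> s" .
  then have "s * Bernstein m k x \<le> 1"
    using s by (simp add: power2_eq_square flip: s(2))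
  then show ?thesis
    unfolding V_def[symmetric] s_def[symmetric] using s by (simp add: field_simps)
qed

lemma pmf_binomial_le:
  fixes p :: real
  assumes "0 < p" "p < 1"
  shows "pmf (binomial_pmf m p) k \<le> 1 / sqrt (real (Suc m) * p * (1 - p))"
  using Bernstein_le[OF assms, of m k] assms by (simp add: Bernstein_def)

section \<open>Independence of blocks of coordinates in product measures\<close>

text \<open>Sample the coordinates outside \<open>R\<close> first. They decide \<open>Q\<close>, and
  whatever their values \<open>h\<close> are, \<open>B\<close> then has conditional probability at
  most \<open>\<beta>\<close>; integrate over \<open>h\<close>.\<close>

lemma prob_Pi_pmf_conditional_le:
  fixes B :: "('a \<Rightarrow> 'b) \<Rightarrow> bool"
  assumes fin: "finite \<Omega>" and R: "R \<subseteq> \<Omega>" and \<beta>: "0 \<le> \<beta>"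
    and Q: "\<And>f g. (\<And>x. x \<notin> R \<Longrightarrow> f x = g x) \<Longrightarrow> Q f = Q g"
    and B: "\<And>h. measure_pmf.prob (Pi_pmf R dflt P) {g. B (\<lambda>x. if x \<in> R then g x else h x)} \<le> \<beta>"
  shows "measure_pmf.prob (Pi_pmf \<Omega> dflt P) {f. Q f \<and> B f}
    \<le> \<beta> * measure_pmf.prob (Pi_pmf \<Omega> dflt P) {f. Q f}"
proof -
  define m where "m = (\<lambda>(g::'a \<Rightarrow> 'b) h x. if x \<in> R then g x else h x)"
  let ?R = "Pi_pmf R dflt P" and ?S = "Pi_pmf (\<Omega> - R) dflt P"
  have "\<Omega> = R \<union> (\<Omega> - R)" using R by auto
  then have "Pi_pmf \<Omega> dflt P = map_pmf (\<lambda>(g, h). m g h) (pair_pmf ?R ?S)"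
    using Pi_pmf_union[of R "\<Omega> - R" dflt P] fin R finite_subset[OF R fin] by (auto simp: m_def)
  also have "\<dots> = bind_pmf ?S (\<lambda>h. map_pmf (\<lambda>g. m g h) ?R)"
    by (subst pair_commute_pmf)
      (simp add: pair_pmf_def map_pmf_def bind_assoc_pmf bind_return_pmf)
  finally have split: "Pi_pmf \<Omega> dflt P = \<dots>" .
  have Qm: "Q (m g h) = Q h" for g h by (rule Q) (simp add: m_def)
  let ?e = "\<lambda>M X. emeasure (measure_pmf M) X"
  have pre: "((\<lambda>g. m g h) -` {f. Q f \<and> B f}) = (if Q h then {g. B (m g h)} else {})" 
    "((\<lambda>g. m g h) -` {f. Q f}) = (if Q h then UNIV else {})" for h
    unfolding vimage_def by (auto simp: Qm)
  have "?e (Pi_pmf \<Omega> dflt P) {f. Q f \<and> B f}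
      = (\<integral>\<^sup>+h. ?e ?R (if Q h then {g. B (m g h)} else {}) \<partial>?S)"
    by (simp only: split emeasure_bind_pmf emeasure_map_pmf pre)
  also have "\<dots> \<le> (\<integral>\<^sup>+h. ennreal \<beta> * ?e ?R (if Q h then UNIV else {}) \<partial>?S)"
    using B \<beta> by (intro nn_integral_mono)
      (auto simp: m_def measure_pmf.emeasure_eq_measure simp flip: ennreal_mult)
  also have "\<dots> = ennreal \<beta> * ?e (Pi_pmf \<Omega> dflt P) {f. Q f}"
    by (simp only: split emeasure_bind_pmf emeasure_map_pmf pre)
      (rule nn_integral_cmult, simp)
  finally show ?thesis
    using \<beta> by (simp add: measure_pmf.emeasure_eq_measure flip: ennreal_mult)
qed

text \<open>Each \<open>B i\<close> may read its own block and the coordinates outside all blocks,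
  but no other block. So the conditional bound can be applied to one block at a time.\<close>

lemma prob_Pi_pmf_blocks_le:
  fixes B :: "'i \<Rightarrow> ('a \<Rightarrow> 'b) \<Rightarrow> bool"
  assumes fin: "finite \<Omega>" and "finite I" and \<beta>: "0 \<le> \<beta>"
    and R: "\<And>i. i \<in> I \<Longrightarrow> R i \<subseteq> \<Omega>"
    and indep: "\<And>i j f g. i \<in> I \<Longrightarrow> j \<in> I \<Longrightarrow> i \<noteq> j \<Longrightarrow> (\<And>x. x \<notin> R j \<Longrightarrow> f x = g x) \<Longrightarrow> B i f = B i g"
    and B: "\<And>i h. i \<in> I \<Longrightarrow>
      measure_pmf.prob (Pi_pmf (R i) dflt P) {g. B i (\<lambda>x. if x \<in> R i then g x else h x)} \<le> \<beta>"
  shows "measure_pmf.prob (Pi_pmf \<Omega> dflt P) {f. \<forall>i\<in>I. B i f} \<le> \<beta> ^ card I"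
  using assms(2) R indep B
proof (induction I)
  case empty
  then show ?case by simp
next
  case (insert i I)
  have "measure_pmf.prob (Pi_pmf \<Omega> dflt P) {f. (\<forall>j\<in>I. B j f) \<and> B i f}
      \<le> \<beta> * measure_pmf.prob (Pi_pmf \<Omega> dflt P) {f. \<forall>j\<in>I. B j f}"
  proof (rule prob_Pi_pmf_conditional_le[OF fin _ \<beta>])
    show "R i \<subseteq> \<Omega>" using insert.prems(1) by simp
    show "(\<forall>j\<in>I. B j f) = (\<forall>j\<in>I. B j g)" if "\<And>x. x \<notin> R i \<Longrightarrow> f x = g x" for f g
      using insert.prems(2)[of _ i f g] insert.hyps that by (metis insertCI)
  qed (use insert.prems(3) in simp)
  also have "\<dots> \<le> \<beta> * \<beta> ^ card I"
    using insert.prems by (intro mult_left_mono insert.IH \<beta>) blast+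
  finally show ?case using insert.hyps by (simp add: conj_commute)
qed

text \<open>Once everything outside block \<open>i\<close> is fixed, the target \<open>t i\<close>
  is a constant and the count in the block is binomial with at least \<open>r\<close> trials, so the
  bound on point probabilities applies.\<close>

lemma prob_block_cards_le:
  fixes R :: "'i \<Rightarrow> 'a set" and t :: "'i \<Rightarrow> ('a \<Rightarrow> bool) \<Rightarrow> nat" and p :: real
  assumes p: "0 < p" "p < 1" and fin: "finite \<Omega>" "finite I"
    and R: "\<And>i. i \<in> I \<Longrightarrow> R i \<subseteq> \<Omega>" "disjoint_family_on R I"
    and r: "\<And>i. i \<in> I \<Longrightarrow> r \<le> card (R i)"
    and t: "\<And>i f g. i \<in> I \<Longrightarrow> (\<And>x. x \<notin> (\<Union>i\<in>I. R i) \<Longrightarrow> f x = g x) \<Longrightarrow> t i f = t i g"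
  shows "measure_pmf.prob (Pi_pmf \<Omega> False (\<lambda>_. bernoulli_pmf p))
      {f. \<forall>i\<in>I. card {x \<in> R i. f x} = t i f} \<le> (1 / sqrt (real (Suc r) * p * (1 - p))) ^ card I"
proof (rule prob_Pi_pmf_blocks_le[where R = R, OF fin])
  show "0 \<le> 1 / sqrt (real (Suc r) * p * (1 - p))" using p by simp
  fix i assume i: "i \<in> I"
  show "R i \<subseteq> \<Omega>" using R(1) i .
  show "(card {x \<in> R i. f x} = t i f) = (card {x \<in> R i. g x} = t i g)"
    if "j \<in> I" "i \<noteq> j" "\<And>x. x \<notin> R j \<Longrightarrow> f x = g x" for j f g
  proof -
    have "R i \<inter> R j = {}"
      using R(2) i that(1,2) by (auto simp: disjoint_family_on_def)
    then have "{x \<in> R i. f x} = {x \<in> R i. g x}" using that(3) by blast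
    moreover have "t i f = t i g" using that by (intro t i) auto
    ultimately show ?thesis by simp
  qed
  fix h :: "'a \<Rightarrow> bool"
  let ?m = "\<lambda>g x. if x \<in> R i then g x else h x"
  have tm: "t i (?m g) = t i h" for g by (rule t[OF i]) (use i in auto)
  have finR: "finite (R i)" using R(1)[OF i] fin(1) finite_subset by blast
  have "{g. card {x \<in> R i. ?m g x} = t i (?m g)} = (\<lambda>g. card {x \<in> R i. g x}) -` {t i h}"
    unfolding tm by (simp add: vimage_def conj_commute cong: conj_cong)
  then have "measure_pmf.prob (Pi_pmf (R i) False (\<lambda>_. bernoulli_pmf p))
        {g. card {x \<in> R i. ?m g x} = t i (?m g)}
      = pmf (binomial_pmf (card (R i)) p) (t i h)"
    using binomial_pmf_altdef'[OF finR refl, of p False] p by (simp add: pmf_map)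
  also have "\<dots> \<le> 1 / sqrt (real (Suc (card (R i))) * p * (1 - p))"
    by (rule pmf_binomial_le[OF p])
  also have "\<dots> \<le> 1 / sqrt (real (Suc r) * p * (1 - p))"
    using p r[OF i] by (intro divide_left_mono real_sqrt_le_mono mult_right_mono mult_pos_pos) auto
  finally show "measure_pmf.prob (Pi_pmf (R i) False (\<lambda>_. bernoulli_pmf p))
        {g. card {x \<in> R i. ?m g x} = t i (?m g)} \<le> \<dots>" .
qed

section \<open>Markov's inequality, counting and a limit\<close>

text \<open>Markov's inequality for the number of events \<open>A j\<close> that occur.\<close>

lemma prob_card_events_le:
  fixes M :: "'a pmf" and A :: "'j \<Rightarrow> 'a set"
  assumes "finite J"
  shows "real k * measure_pmf.prob M {x. k \<le> card {j \<in> J. x \<in> A j}}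
    \<le> (\<Sum>j\<in>J. measure_pmf.prob M (A j))"
proof -
  let ?X = "{x. k \<le> card {j \<in> J. x \<in> A j}}"
  have "real k * measure_pmf.prob M ?X = measure_pmf.expectation M (\<lambda>x. real k * indicator ?X x)"
    by simp
  also have "\<dots> \<le> measure_pmf.expectation M (\<lambda>x. \<Sum>j\<in>J. indicator (A j) x)"
  proof (rule integral_mono)
    fix x
    have "(\<Sum>j\<in>J. indicator (A j) x :: real) = real (card {j \<in> J. x \<in> A j})"
      using assms by (simp add: indicator_def sum.If_cases Int_def)
    then show "real k * indicator ?X x \<le> (\<Sum>j\<in>J. indicator (A j) x :: real)"
      by (auto simp: indicator_def)
  qed (auto intro!: integrable_real_indicator Bochner_Integration.integrable_sum
      simp: measure_pmf.emeasure_eq_measure)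
  also have "\<dots> = (\<Sum>j\<in>J. measure_pmf.prob M (A j))"
    by (subst Bochner_Integration.integral_sum)
      (auto intro!: integrable_real_indicator simp: measure_pmf.emeasure_eq_measure)
  finally show ?thesis .
qed

text \<open>A set of at most \<open>s\<close> vertices is encoded by a list of length
  \<open>s\<close> over \<open>{..n}\<close>, where the non-vertex \<open>n\<close> serves as
  padding.\<close>

lemma card_small_subsets_le: "card {A. A \<subseteq> {..<n} \<and> card A \<le> s} \<le> (n + 1) ^ s"
proof -
  let ?L = "{xs :: nat list. set xs \<subseteq> {..n} \<and> length xs = s}"
  have "{A. A \<subseteq> {..<n} \<and> card A \<le> s} \<subseteq> (\<lambda>xs. set xs - {n}) ` ?L"
  proof safe
    fix A :: "nat set" assume A: "A \<subseteq> {..<n}" "card A \<le> s"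
    then have "finite A" using finite_subset by blast
    then obtain ys where ys: "set ys = A" "length ys = card A"
      using finite_distinct_list distinct_card by metis
    show "A \<in> (\<lambda>xs. set xs - {n}) ` ?L"
      using A ys by (intro image_eqI[of _ _ "ys @ replicate (s - card A) n"]) auto
  qed
  then have "card {A. A \<subseteq> {..<n} \<and> card A \<le> s} \<le> card ((\<lambda>xs. set xs - {n}) ` ?L)"
    by (intro card_mono finite_imageI finite_lists_length_eq) auto
  also have "\<dots> \<le> card ?L"
    by (intro card_image_le finite_lists_length_eq) auto
  also have "\<dots> = (n + 1) ^ s"
    by (subst card_lists_length_eq) auto
  finally show ?thesis .
qed

lemma card_residue_class_ge:
  assumes "i < 4"
  shows "n div 4 \<le> card {x \<in> {..<n}. x mod 4 = i}"
proof -
  have "(\<lambda>k. 4 * k + i) ` {..<n div 4} \<subseteq> {x \<in> {..<n}. x mod 4 = i}"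
    using assms by auto
  moreover have "inj_on (\<lambda>k. 4 * k + i) {..<n div 4}" by (auto simp: inj_on_def)
  ultimately show ?thesis
    using card_mono[of "{x \<in> {..<n}. x mod 4 = i}" "(\<lambda>k. 4 * k + i) ` {..<n div 4}"]
    by (simp add: card_image)
qed

lemma card_residue_class_Diff_ge:
  assumes "i < 4" "finite T"
  shows "n div 4 - card T \<le> card {x \<in> {..<n}. x mod 4 = i \<and> x \<notin> T}"
proof -
  have "{x \<in> {..<n}. x mod 4 = i \<and> x \<notin> T} = {x \<in> {..<n}. x mod 4 = i} - T" by auto
  then show ?thesis
    using diff_card_le_card_Diff[OF assms(2), of "{x \<in> {..<n}. x mod 4 = i}"] card_residue_class_ge[OF assms(1), of n]
    by simp
qed

text \<open>Needed for a union bound over polynomially many events of exponentially small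
  probability.\<close>

lemma poly_times_exponential_tendsto_0:
  fixes c :: real
  assumes "0 < c" "c < 1" "0 < k"
  shows "(\<lambda>n. (real n + 1) ^ k * c ^ (n div 4 - s)) \<longlonglongrightarrow> 0"
proof -
  \<comment> \<open>With \<open>d ^ k = c\<close> the sequence becomes the \<open>k\<close>-th power
    of \<open>m * d ^ m\<close>, which reduces the claim to a linear factor.\<close>
  define d where "d = root k c"
  have d: "0 < d" "d < 1" "d ^ k = c"
    using assms by (auto simp: d_def real_root_pow_pos2)
  have "(\<lambda>m. (real m * d ^ m) ^ k) \<longlonglongrightarrow> 0 ^ k"
    using d by (intro tendsto_power powser_times_n_limit_0) auto
  then have "(\<lambda>m. real m ^ k * c ^ m) \<longlonglongrightarrow> 0"
    using assms(3) by (simp add: power_mult_distrib zero_power power_commutes flip: d(3) power_mult)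
      (simp add: mult.commute)
  then have "(\<lambda>m. 4 ^ k / c / c ^ s * (real (Suc m) ^ k * c ^ Suc m)) \<longlonglongrightarrow> 4 ^ k / c / c ^ s * 0"
    by (intro tendsto_mult tendsto_const LIMSEQ_Suc)
  also have "(\<lambda>m. 4 ^ k / c / c ^ s * (real (Suc m) ^ k * c ^ Suc m)) =
      (\<lambda>m. (4 * real m + 4) ^ k * (c ^ m / c ^ s))"
  proof
    fix m
    have "4 * real m + 4 = 4 * real (Suc m)" by simp
    then show "4 ^ k / c / c ^ s * (real (Suc m) ^ k * c ^ Suc m) = (4 * real m + 4) ^ k * (c ^ m / c ^ s)"
      using assms by (simp only: power_mult_distrib) simp
  qed
  finally have "(\<lambda>m. (4 * real m + 4) ^ k * (c ^ m / c ^ s)) \<longlonglongrightarrow> 0" by simp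
  then have lim: "(\<lambda>n. (4 * real (n div 4) + 4) ^ k * (c ^ (n div 4) / c ^ s)) \<longlonglongrightarrow> 0"
    by (rule filterlim_compose) (simp add: filterlim_at_top_div_const_nat)
  show ?thesis
  proof (rule tendsto_sandwich[OF _ _ tendsto_const lim])
    show "\<forall>\<^sub>F n in sequentially. 0 \<le> (real n + 1) ^ k * c ^ (n div 4 - s)"
      using assms by simp
    show "\<forall>\<^sub>F n in sequentially. (real n + 1) ^ k * c ^ (n div 4 - s)
        \<le> (4 * real (n div 4) + 4) ^ k * (c ^ (n div 4) / c ^ s)"
      \<comment> \<open>From here on the subtraction \<open>n div 4 - s\<close> is not
        truncated.\<close>
      using eventually_ge_at_top[of "4 * s"]
    proof eventually_elim
      case (elim n)
      then have "s \<le> n div 4" by linarith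
      then have "c ^ (n div 4) / c ^ s = c ^ (n div 4 - s)"
        using assms by (simp add: power_diff)
      moreover have "real n + 1 \<le> 4 * real (n div 4) + 4" by linarith
      ultimately show ?case
        using assms by (intro mult_mono power_mono) auto
    qed
  qed
qed

section \<open>Near pairs and the deterministic repair\<close>

text \<open>An entry of the signature for the residue classes, written in terms of the edge
  indicator \<open>f\<close> on which the product measure lives. The condition
  \<open>x \<noteq> v\<close> excludes the singleton \<open>{v}\<close>, which is no potential
  edge.\<close>

definition class_degree :: "nat \<Rightarrow> nat \<Rightarrow> (nat set \<Rightarrow> bool) \<Rightarrow> nat \<Rightarrow> nat" where
  "class_degree n i f v = card {x \<in> {..<n}. x mod 4 = i \<and> x \<noteq> v \<and> f {x, v}}"

text \<open>
  Natural number encoding of the vector \<open>(e - 1) \<sqdot> (1, -1, 0, 0)\<close> for \<open>e \<le> 2\<close>, with 1 added to each entry.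
\<close>

definition shift :: "nat \<Rightarrow> nat \<Rightarrow> nat" where
  "shift e i = (if i = 0 then e else if i = 1 then 2 - e else 1)"

text \<open>The 1 on the left cancels the 1 built into \<open>shift\<close>, so that no subtraction
  of natural numbers occurs.\<close>

definition shifted :: "nat \<Rightarrow> (nat set \<Rightarrow> bool) \<Rightarrow> nat \<Rightarrow> nat \<Rightarrow> nat \<Rightarrow> bool" where
  "shifted n f e u v \<longleftrightarrow> (\<forall>i<4. class_degree n i f u + 1 = class_degree n i f v + shift e i)"

definition near :: "nat \<Rightarrow> (nat set \<Rightarrow> bool) \<Rightarrow> nat \<Rightarrow> nat \<Rightarrow> bool" where
  "near n f u v \<longleftrightarrow> u < n \<and> v < n \<and> u \<noteq> v \<and> (\<exists>e<3. shifted n f e u v)"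

lemma all_less_4: "(\<forall>i<4. P i) \<longleftrightarrow> P 0 \<and> P 1 \<and> P 2 \<and> P (3::nat)"
  by (simp add: numeral_eq_Suc All_less_Suc conj_ac)

text \<open>Swapping the vertices negates the difference vector, which turns \<open>e\<close> into
  \<open>2 - e\<close>.\<close>

lemma near_sym: "near n f u v \<Longrightarrow> near n f v u"
proof -
  assume "near n f u v"
  then obtain e where e: "e < 3" "shifted n f e u v" and uv: "u < n" "v < n" "u \<noteq> v"
    by (auto simp: near_def)
  have "shifted n f (2 - e) v u"
    using e by (auto simp: shifted_def shift_def all_less_4)
  moreover have "2 - e < 3" by simp
  ultimately show ?thesis using uv by (auto simp: near_def)
qed

text \<open>The extension property, with the witness confined to class 0, the class it will be moved
  out of.\<close>

definition extendable :: "nat \<Rightarrow> nat \<Rightarrow> (nat set \<Rightarrow> bool) \<Rightarrow> bool" where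
  "extendable n s f \<longleftrightarrow> (\<forall>A B. A \<subseteq> {..<n} \<longrightarrow> B \<subseteq> {..<n} \<longrightarrow> A \<inter> B = {} \<longrightarrow> card (A \<union> B) \<le> s \<longrightarrow>
     (\<exists>w<n. w mod 4 = 0 \<and> w \<notin> A \<union> B \<and> (\<forall>x\<in>A. f {x, w}) \<and> (\<forall>x\<in>B. \<not> f {x, w})))"

lemma multiset_chromatic_number_le_4:
  assumes n: "8 \<le> n"
    and uniq: "\<And>u v w. near n f u v \<Longrightarrow> near n f w v \<Longrightarrow> u = w"
    and few: "card {u. \<exists>v. near n f u v} \<le> s"
    and ext: "extendable n s f"
  shows "multiset_chromatic_number {..<n} {e \<in> nsets {..<n} 2. f e} \<le> 4"
proof -
  define N where "N = {u. \<exists>v. near n f u v}"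
  \<comment> \<open>A near pair with equal degrees into class 0 has \<open>e = 1\<close>, so its
    signatures coincide. \<open>A\<close> takes the smaller vertex of each such pair.\<close>
  define A where "A = {u \<in> N. \<exists>v. near n f u v \<and> u < v \<and> class_degree n 0 f u = class_degree n 0 f v}"
  have "N \<subseteq> {..<n}" by (auto simp: N_def near_def)
  moreover have AN: "A \<union> (N - A) = N" by (auto simp: A_def)
  ultimately have "\<exists>w<n. w mod 4 = 0 \<and> w \<notin> A \<union> (N - A) \<and> (\<forall>x\<in>A. f {x, w}) \<and> (\<forall>x\<in>N - A. \<not> f {x, w})"
    using ext[unfolded extendable_def, rule_format, of A "N - A"] few AN
    by (auto simp: N_def[symmetric])
  then obtain w where w: "w < n" "w mod 4 = 0" "w \<notin> N"
    and wAB: "\<forall>x\<in>A. f {x, w}" "\<forall>x\<in>N - A. \<not> f {x, w}"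
    unfolding AN by (elim exE conjE) (rule that)
  define P where "P i = {x \<in> {..<n}. x mod 4 = i}" for i :: nat
  define Ps where "Ps = [P 0 - {w}, insert w (P 1), P 2, P 3]"
  let ?E = "{e \<in> nsets {..<n} 2. f e}"
  \<comment> \<open>The move of \<open>w\<close> lowers entry 0 of the signature of \<open>v\<close>
    by \<open>?a v\<close> and raises entry 1 by the same amount.\<close>
  let ?a = "\<lambda>v. of_bool (v \<noteq> w \<and> f {w, v}) :: nat"
  have mem: "(if w = 0 then 4 else 0) \<in> P 0 - {w}" "1 \<in> P 1" "2 \<in> P 2" "3 \<in> P 3"
    using n by (simp_all add: P_def)
  have P_mod: "x mod 4 = i" if "x \<in> P i" for x i using that by (simp add: P_def)
  have wP: "w \<in> P 0" "w \<notin> P 1" "w \<notin> P 2" "w \<notin> P 3" using w by (auto simp: P_def)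
  have un: "\<Union>(set Ps) = {..<n}"
  proof
    show "\<Union>(set Ps) \<subseteq> {..<n}" using w(1) by (auto simp: Ps_def P_def)
    show "{..<n} \<subseteq> \<Union>(set Ps)"
    proof
      fix x assume "x \<in> {..<n}"
      then have "x \<in> P (x mod 4)" by (simp add: P_def)
      moreover have "x mod 4 < 4" by simp
      then have "x mod 4 = 0 \<or> x mod 4 = 1 \<or> x mod 4 = 2 \<or> x mod 4 = 3" by linarith
      ultimately have "x \<in> P 0 \<or> x \<in> P 1 \<or> x \<in> P 2 \<or> x \<in> P 3" by metis
      then show "x \<in> \<Union>(set Ps)" by (auto simp: Ps_def)
    qed
  qed
  have disj: "(P 0 - {w}) \<inter> insert w (P 1) = {}" "(P 0 - {w}) \<inter> P 2 = {}" "(P 0 - {w}) \<inter> P 3 = {}"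
    "insert w (P 1) \<inter> P 2 = {}" "insert w (P 1) \<inter> P 3 = {}" "P 2 \<inter> P 3 = {}"
    using w(2) by (auto dest!: P_mod)
  have "P 0 - {w} \<noteq> {}" "P 2 \<noteq> {}" "P 3 \<noteq> {}" using mem by blast+
  then have ne: "{} \<notin> set Ps" by (simp add: Ps_def)
  have neq: "X \<noteq> Y" if "X \<inter> Y = {}" "x \<in> X" for X Y :: "nat set" and x using that by auto
  have "distinct Ps"
    unfolding Ps_def using neq[OF disj(1) mem(1)] neq[OF disj(2) mem(1)] neq[OF disj(3) mem(1)]
      neq[OF disj(4) insertI1] neq[OF disj(5) insertI1] neq[OF disj(6) mem(3)]
    by simp
  moreover have "disjoint (set Ps)"
    using disj by (auto simp: disjoint_def Ps_def Int_commute)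
  ultimately have part: "ordered_partition {..<n} Ps"
    using un ne by (simp add: ordered_partition_def partition_on_def)
  have deg: "class_degree n i f v = card (nbhd {..<n} ?E v \<inter> P i)" if "v < n" for i v
    using that by (auto simp: class_degree_def nbhd_def P_def intro!: arg_cong[where f = card])
  have fin: "finite (nbhd {..<n} ?E v)" for v by (simp add: nbhd_def)
  have w_nbhd: "w \<in> nbhd {..<n} ?E v \<longleftrightarrow> v \<noteq> w \<and> f {w, v}" if "v < n" for v
    using that w by (auto simp: nbhd_def)
  have deg0: "class_degree n 0 f v = card (nbhd {..<n} ?E v \<inter> (P 0 - {w})) + ?a v" if v: "v < n" for v
  proof (cases "w \<in> nbhd {..<n} ?E v")
    case True
    then have "nbhd {..<n} ?E v \<inter> P 0 = insert w (nbhd {..<n} ?E v \<inter> (P 0 - {w}))" using wP by auto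
    then show ?thesis using True fin v by (simp add: deg w_nbhd)
  next
    case False
    then have "nbhd {..<n} ?E v \<inter> P 0 = nbhd {..<n} ?E v \<inter> (P 0 - {w})" by auto
    then show ?thesis using False fin v by (simp add: deg w_nbhd)
  qed
  have deg1: "card (nbhd {..<n} ?E v \<inter> insert w (P 1)) = class_degree n 1 f v + ?a v" if v: "v < n" for v
    using fin v wP w_nbhd[OF v] by (auto simp: deg)
  have clash: False
    if uv: "u < v" "v < n" and eq: "signature {..<n} ?E Ps u = signature {..<n} ?E Ps v" for u v
  proof -
    have u: "u < n" using uv by simp
    have d0: "class_degree n 0 f u + ?a v = class_degree n 0 f v + ?a u"
      using eq by (simp add: signature_def Ps_def deg0[OF u] deg0[OF uv(2)])
    have d1: "class_degree n 1 f u + ?a u = class_degree n 1 f v + ?a v"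
      using eq unfolding deg1[OF u, symmetric] deg1[OF uv(2), symmetric]
      by (simp add: signature_def Ps_def)
    have d23: "class_degree n 2 f u = class_degree n 2 f v" "class_degree n 3 f u = class_degree n 3 f v"
      using eq by (simp_all add: signature_def Ps_def deg u uv(2))
    \<comment> \<open>Equal signatures after the move mean that the old ones differed by
      \<open>a - b\<close> in entry 0 and by \<open>b - a\<close> in entry 1. As
      \<open>b \<le> 1\<close>, the subtraction is exact.\<close>
    have "shifted n f (1 + a - b) u v"
      if "a \<le> 1" "b \<le> 1" "class_degree n 0 f u + b = class_degree n 0 f v + a"
        "class_degree n 1 f u + a = class_degree n 1 f v + b" for a b
      unfolding shifted_def shift_def all_less_4 using that d23 by simp arith
    from this[OF _ _ d0 d1] have "shifted n f (1 + ?a u - ?a v) u v" by simp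
    moreover have "1 + ?a u - ?a v < 3" by (simp add: of_bool_def)
    ultimately have nr: "near n f u v" using u uv by (auto simp: near_def)
    then have uvN: "u \<in> N" "v \<in> N" using near_sym[OF nr] by (auto simp: N_def)
    then have a: "?a u = of_bool (u \<in> A)" "?a v = of_bool (v \<in> A)"
      using wAB w(3) by (auto simp: insert_commute)
    have v_notin: "v \<notin> A"
    proof
      assume "v \<in> A"
      then obtain v' where "near n f v v'" "v < v'" by (auto simp: A_def)
      then show False using uniq[OF nr near_sym, of v'] uv by simp
    qed
    show False
    \<comment> \<open>If the pair collided before the move, \<open>w\<close> is adjacent to
      \<open>u\<close> only and separates it. Otherwise \<open>w\<close> is adjacent to neither
      vertex, and the old difference in entry 0 survives.\<close>
    proof (cases "class_degree n 0 f u = class_degree n 0 f v")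
      case True
      then have "u \<in> A" using nr uv uvN by (auto simp: A_def)
      then show False using d0 True a v_notin by simp
    next
      case False
      have "u \<notin> A"
      proof
        assume "u \<in> A"
        then obtain v' where "near n f u v'" "class_degree n 0 f u = class_degree n 0 f v'"
          by (auto simp: A_def)
        then show False using uniq[OF near_sym[OF nr] near_sym, of v'] False by simp
      qed
      then show False using d0 False a v_notin by simp
    qed
  qed
  have "multiset_coloring {..<n} ?E Ps"
    unfolding multiset_coloring_def
  proof (intro conjI allI impI part notI)
    fix u v assume e: "{u, v} \<in> ?E" and eq: "signature {..<n} ?E Ps u = signature {..<n} ?E Ps v"
    have "u < n" "v < n" "u \<noteq> v" using e by auto
    then show False using clash[of u v] clash[of v u] eq by (metis nat_neq_iff)
  qed
  then have "\<exists>Qs. multiset_coloring {..<n} ?E Qs \<and> length Qs = 4"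
    by (intro exI[of _ Ps]) (simp add: Ps_def)
  then show ?thesis
    unfolding multiset_chromatic_number_def by (rule Least_le)
qed

section \<open>Probability estimates for near pairs and for the extension property\<close>

abbreviation edge_pmf :: "nat \<Rightarrow> real \<Rightarrow> (nat set \<Rightarrow> bool) pmf" where
  "edge_pmf n p \<equiv> Pi_pmf (nsets {..<n} 2) False (\<lambda>_. bernoulli_pmf p)"

lemma finite_nsets_lessThan [simp]: "finite (nsets {..<n::nat} k)"
  by (simp add: finite_imp_finite_nsets)

text \<open>Reveal all edges except those from \<open>U\<close> to vertices outside \<open>U\<close>
  and \<open>v\<close>. Then each \<open>u\<close> in \<open>U\<close> must hit a prescribed count
  in each of the four classes, on disjoint sets of unrevealed edges. Sets \<open>U\<close> of size 1
  and 2 serve near pairs and pairs of near pairs sharing a vertex.\<close>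

lemma prob_shifted_le:
  fixes p :: real
  assumes p: "0 < p" "p < 1" and U: "U \<subseteq> {..<n}" "v < n" "v \<notin> U" "card U \<le> 2"
  shows "measure_pmf.prob (edge_pmf n p) {f. \<forall>u\<in>U. shifted n f (e u) u v}
    \<le> (1 / sqrt (real (Suc (n div 4 - 3)) * p * (1 - p))) ^ (4 * card U)"
proof -
  define T where "T = insert v U"
  have finU: "finite U" using U(1) finite_subset by blast
  have T: "finite T" "card T \<le> 3" "T \<subseteq> {..<n}" using finU U by (auto simp: T_def)
  define X where "X i = {x \<in> {..<n}. x mod 4 = i \<and> x \<notin> T}" for i :: nat
  define R where "R = (\<lambda>(u, i). (\<lambda>x. {x, u}) ` X i)"
  \<comment> \<open>The target is the degree demanded of \<open>u\<close>, less its edges into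
    \<open>T\<close>. Truncation is harmless, since only the implication from \<open>shifted\<close>
    to hitting the target is used.\<close>
  define t where "t = (\<lambda>(u, i) f. class_degree n i f v + shift (e u) i - 1
    - card {x \<in> {..<n}. x mod 4 = i \<and> x \<in> T \<and> x \<noteq> u \<and> f {x, u}})"
  let ?I = "U \<times> {..<4::nat}"
  have inj: "inj_on (\<lambda>x. {x, u}) Y" for u :: nat and Y by (auto simp: inj_on_def doubleton_eq_iff)
  have R_elem: "\<exists>x u. y = {x, u} \<and> x \<notin> T \<and> u \<in> U" if "y \<in> (\<Union>k\<in>?I. R k)" for y
    using that by (auto simp: R_def X_def)
  have "card {y \<in> R (u, i). f y} = t (u, i) f"
    if sh: "\<forall>u\<in>U. shifted n f (e u) u v" and ui: "u \<in> U" "i < 4" for u i f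
  proof -
    have "{y \<in> R (u, i). f y} = (\<lambda>x. {x, u}) ` {x \<in> X i. f {x, u}}" by (auto simp: R_def)
    then have c: "card {y \<in> R (u, i). f y} = card {x \<in> X i. f {x, u}}"
      using card_image[OF inj] by simp
    have "{x \<in> {..<n}. x mod 4 = i \<and> x \<noteq> u \<and> f {x, u}} =
        {x \<in> X i. f {x, u}} \<union> {x \<in> {..<n}. x mod 4 = i \<and> x \<in> T \<and> x \<noteq> u \<and> f {x, u}}"
      using ui by (auto simp: X_def T_def)
    then have "class_degree n i f u = card {y \<in> R (u, i). f y} +
        card {x \<in> {..<n}. x mod 4 = i \<and> x \<in> T \<and> x \<noteq> u \<and> f {x, u}}"
      unfolding class_degree_def c by (subst card_Un_disjoint[symmetric]) (auto simp: X_def)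
    moreover have "class_degree n i f u + 1 = class_degree n i f v + shift (e u) i"
      using sh ui by (simp add: shifted_def)
    ultimately show ?thesis by (simp add: t_def)
  qed
  then have "measure_pmf.prob (edge_pmf n p) {f. \<forall>u\<in>U. shifted n f (e u) u v}
      \<le> measure_pmf.prob (edge_pmf n p) {f. \<forall>k\<in>?I. card {y \<in> R k. f y} = t k f}"
    by (intro measure_pmf.finite_measure_mono) auto
  also have "\<dots> \<le> (1 / sqrt (real (Suc (n div 4 - 3)) * p * (1 - p))) ^ card ?I"
  proof (rule prob_block_cards_le[OF p])
    show "finite ?I" using finU by simp
    show "R k \<subseteq> nsets {..<n} 2" if "k \<in> ?I" for k
      using that U(1) by (auto simp: R_def X_def T_def)
    show "disjoint_family_on R ?I"
    proof (unfold disjoint_family_on_def, intro ballI impI)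
      fix k l assume kl: "k \<in> ?I" "l \<in> ?I" "k \<noteq> l"
      obtain u i u' i' where "k = (u, i)" "l = (u', i')" by (cases k, cases l)
      then show "R k \<inter> R l = {}"
        using kl by (auto simp: R_def X_def T_def doubleton_eq_iff)
    qed
    show "n div 4 - 3 \<le> card (R k)" if "k \<in> ?I" for k
    proof -
      obtain u i where k: "k = (u, i)" "i < 4" using \<open>k \<in> ?I\<close> by auto
      have "n div 4 - 3 \<le> n div 4 - card T" using T by simp
      also have "\<dots> \<le> card (X i)" unfolding X_def by (rule card_residue_class_Diff_ge[OF k(2) T(1)])
      finally show ?thesis using card_image[OF inj] by (simp add: k R_def)
    qed
    fix k and f g :: "nat set \<Rightarrow> bool" assume k: "k \<in> ?I" and fg: "\<And>y. y \<notin> (\<Union>k\<in>?I. R k) \<Longrightarrow> f y = g y"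
    obtain u i where ui: "k = (u, i)" "u \<in> U" using k by auto
    have "f {x, v} = g {x, v}" for x
    proof (rule fg, rule notI)
      assume "{x, v} \<in> (\<Union>k\<in>?I. R k)"
      from R_elem[OF this] show False using U(3) by (auto simp: T_def doubleton_eq_iff)
    qed
    then have 1: "class_degree n i f v = class_degree n i g v" by (simp add: class_degree_def)
    have "f {x, u} = g {x, u}" if "x \<in> T" for x
    proof (rule fg, rule notI)
      assume "{x, u} \<in> (\<Union>k\<in>?I. R k)"
      from R_elem[OF this] show False using that ui by (auto simp: T_def doubleton_eq_iff)
    qed
    then have "{x \<in> {..<n}. x mod 4 = i \<and> x \<in> T \<and> x \<noteq> u \<and> f {x, u}} =
      {x \<in> {..<n}. x mod 4 = i \<and> x \<in> T \<and> x \<noteq> u \<and> g {x, u}}" by blast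
    then show "t k f = t k g" using 1 by (simp add: t_def ui)
  qed simp
  finally show ?thesis by (simp add: card_cartesian_product mult.commute)
qed

text \<open>Union bound over the \<open>3 ^ card U\<close> ways to assign an admissible difference
  to each vertex of \<open>U\<close>.\<close>

lemma prob_near_le:
  fixes p :: real
  assumes p: "0 < p" "p < 1" and U: "U \<subseteq> {..<n}" "v < n" "v \<notin> U" "card U \<le> 2"
  shows "measure_pmf.prob (edge_pmf n p) {f. \<forall>u\<in>U. near n f u v}
    \<le> (3 * (1 / sqrt (real (Suc (n div 4 - 3)) * p * (1 - p))) ^ 4) ^ card U"
proof -
  let ?b = "1 / sqrt (real (Suc (n div 4 - 3)) * p * (1 - p))"
  let ?E = "PiE U (\<lambda>_. {..<3::nat})"
  have finU: "finite U" using U(1) finite_subset by blast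
  then have finE: "finite ?E" by (intro finite_PiE) auto
  have "{f. \<forall>u\<in>U. near n f u v} \<subseteq> (\<Union>e\<in>?E. {f. \<forall>u\<in>U. shifted n f (e u) u v})"
  proof
    fix f assume "f \<in> {f. \<forall>u\<in>U. near n f u v}"
    then have "\<forall>u\<in>U. \<exists>e<3. shifted n f e u v" by (simp add: near_def)
    then obtain e where "\<forall>u\<in>U. e u < 3 \<and> shifted n f (e u) u v" by metis
    then show "f \<in> (\<Union>e\<in>?E. {f. \<forall>u\<in>U. shifted n f (e u) u v})"
      by (intro UN_I[of "restrict e U"]) auto
  qed
  then have "measure_pmf.prob (edge_pmf n p) {f. \<forall>u\<in>U. near n f u v}
      \<le> measure_pmf.prob (edge_pmf n p) (\<Union>e\<in>?E. {f. \<forall>u\<in>U. shifted n f (e u) u v})"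
    by (intro measure_pmf.finite_measure_mono) auto
  also have "\<dots> \<le> (\<Sum>e\<in>?E. measure_pmf.prob (edge_pmf n p) {f. \<forall>u\<in>U. shifted n f (e u) u v})"
    by (intro measure_pmf.finite_measure_subadditive_finite finE) auto
  also have "\<dots> \<le> (\<Sum>e\<in>?E. ?b ^ (4 * card U))"
    by (intro sum_mono prob_shifted_le p U)
  also have "\<dots> = (3 * ?b ^ 4) ^ card U"
    using finU by (simp add: card_PiE power_mult_distrib power_mult)
  finally show ?thesis .
qed

text \<open>Distinct candidates \<open>w\<close> use disjoint sets of edges to
  \<open>A \<union> B\<close>, so they fail independently. Each one succeeds with probability at
  least \<open>min p (1 - p) ^ s\<close>, and at least \<open>n div 4 - s\<close> candidates
  exist.\<close>

lemma prob_no_witness_le: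
  fixes p :: real
  assumes p: "0 < p" "p < 1" and AB: "A \<subseteq> {..<n}" "B \<subseteq> {..<n}" "A \<inter> B = {}" "card (A \<union> B) \<le> s"
  shows "measure_pmf.prob (edge_pmf n p)
      {f. \<not> (\<exists>w<n. w mod 4 = 0 \<and> w \<notin> A \<union> B \<and> (\<forall>x\<in>A. f {x, w}) \<and> (\<forall>x\<in>B. \<not> f {x, w}))}
    \<le> (1 - min p (1 - p) ^ s) ^ (n div 4 - s)"
proof -
  define W where "W = {w \<in> {..<n}. w mod 4 = 0 \<and> w \<notin> A \<union> B}"
  define R where "R w = (\<lambda>x. {x, w}) ` (A \<union> B)" for w :: nat
  define D where "D w f \<longleftrightarrow> \<not> ((\<forall>x\<in>A. f {x, w}) \<and> (\<forall>x\<in>B. \<not> f {x, w}))" for w :: nat and f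
  let ?\<delta> = "min p (1 - p)"
  have \<delta>: "0 < ?\<delta>" "?\<delta> \<le> 1" using p by auto
  have \<delta>s: "0 \<le> 1 - ?\<delta> ^ s" "1 - ?\<delta> ^ s \<le> 1" using \<delta> by (auto intro: power_le_one)
  have fin: "finite (A \<union> B)" using AB finite_subset[of _ "{..<n}"] by auto
  have "{f. \<not> (\<exists>w<n. w mod 4 = 0 \<and> w \<notin> A \<union> B \<and> (\<forall>x\<in>A. f {x, w}) \<and> (\<forall>x\<in>B. \<not> f {x, w}))}
      = {f. \<forall>w\<in>W. D w f}"
    by (auto simp: W_def D_def)
  also have "measure_pmf.prob (edge_pmf n p) \<dots> \<le> (1 - ?\<delta> ^ s) ^ card W"
  proof (rule prob_Pi_pmf_blocks_le[where R = R])
    show "finite W" by (simp add: W_def)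
    show "R w \<subseteq> nsets {..<n} 2" if "w \<in> W" for w
      using that AB by (auto simp: R_def W_def)
    show "D w f = D w g" if ww: "w \<in> W" "w' \<in> W" "w \<noteq> w'" and fg: "\<And>y. y \<notin> R w' \<Longrightarrow> f y = g y" for w w' f g
    proof -
      have "f {x, w} = g {x, w}" if "x \<in> A \<union> B" for x
        using that ww by (intro fg) (auto simp: R_def W_def doubleton_eq_iff)
      then show ?thesis by (simp add: D_def)
    qed
    fix w and h :: "nat set \<Rightarrow> bool" assume w: "w \<in> W"
    let ?M = "Pi_pmf (R w) False (\<lambda>_. bernoulli_pmf p)"
    \<comment> \<open>A singleton set of truth values: the value required of the edge
      \<open>y\<close>, \<open>True\<close> exactly when \<open>y\<close> leads to
      \<open>A\<close>.\<close>
    let ?C = "\<lambda>y. {y \<in> (\<lambda>x. {x, w}) ` A}"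
    have finR: "finite (R w)" using fin by (simp add: R_def)
    have "{x, w} \<notin> (\<lambda>x. {x, w}) ` A" if "x \<in> B" for x
      using that AB(3) by (auto simp: doubleton_eq_iff)
    then have "{g. D w (\<lambda>y. if y \<in> R w then g y else h y)} = space ?M - Pi (R w) ?C"
      by (auto simp: D_def R_def Pi_def)
    then have "measure_pmf.prob ?M {g. D w (\<lambda>y. if y \<in> R w then g y else h y)}
        = 1 - (\<Prod>y\<in>R w. measure_pmf.prob (bernoulli_pmf p) (?C y))"
      using finR measure_pmf.prob_compl[of "Pi (R w) ?C" ?M] by (simp add: measure_Pi_pmf_Pi)
    also have "(\<Prod>y\<in>R w. measure_pmf.prob (bernoulli_pmf p) (?C y)) \<ge> (\<Prod>y\<in>R w. ?\<delta>)"
    proof (rule prod_mono)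
      fix y
      have "measure_pmf.prob (bernoulli_pmf p) {b} \<ge> ?\<delta>" for b
        using p by (cases b) (auto simp: measure_pmf_single)
      then show "0 \<le> ?\<delta> \<and> ?\<delta> \<le> measure_pmf.prob (bernoulli_pmf p) (?C y)"
        using \<delta> by auto
    qed
    moreover have "(\<Prod>y\<in>R w. ?\<delta>) \<ge> ?\<delta> ^ s"
    proof -
      have "card (R w) \<le> card (A \<union> B)" unfolding R_def by (rule card_image_le[OF fin])
      then have "card (R w) \<le> s" using AB(4) by simp
      then show ?thesis using \<delta> by (simp add: power_decreasing)
    qed
    ultimately show "measure_pmf.prob ?M {g. D w (\<lambda>y. if y \<in> R w then g y else h y)} \<le> 1 - ?\<delta> ^ s"
      by linarith
  qed (use \<delta>s in auto)
  also have "\<dots> \<le> (1 - ?\<delta> ^ s) ^ (n div 4 - s)"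
  proof (rule power_decreasing[OF _ \<delta>s])
    show "n div 4 - s \<le> card W"
      using card_residue_class_Diff_ge[of 0 "A \<union> B" n] fin AB(4) unfolding W_def by linarith
  qed
  finally show ?thesis .
qed

text \<open>Union bound over the pairs \<open>(A, B)\<close>, with at most
  \<open>(n + 1) ^ s\<close> choices for each set.\<close>

lemma prob_not_extendable_le:
  fixes p :: real
  assumes p: "0 < p" "p < 1"
  shows "measure_pmf.prob (edge_pmf n p) {f. \<not> extendable n s f}
    \<le> (real n + 1) ^ (2 * s) * (1 - min p (1 - p) ^ s) ^ (n div 4 - s)"
proof -
  let ?F = "{A. A \<subseteq> {..<n} \<and> card A \<le> s}"
  let ?J = "{(A, B) \<in> ?F \<times> ?F. A \<inter> B = {} \<and> card (A \<union> B) \<le> s}"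
  let ?X = "\<lambda>(A, B). {f :: nat set \<Rightarrow> bool. \<not> (\<exists>w<n. w mod 4 = 0 \<and> w \<notin> A \<union> B \<and>
    (\<forall>x\<in>A. f {x, w}) \<and> (\<forall>x\<in>B. \<not> f {x, w}))}"
  let ?c = "(1 - min p (1 - p) ^ s) ^ (n div 4 - s)"
  have c: "0 \<le> ?c" using p by (auto intro!: zero_le_power power_le_one)
  have finF: "finite ?F" by simp
  have finJ: "finite ?J" by (rule finite_subset[of _ "?F \<times> ?F"]) (use finF in auto)
  have "card ?J \<le> card (?F \<times> ?F)" using finF by (intro card_mono) auto
  also have "\<dots> \<le> (n + 1) ^ s * (n + 1) ^ s"
    unfolding card_cartesian_product by (intro mult_mono card_small_subsets_le) auto
  also have "\<dots> = (n + 1) ^ (2 * s)" by (simp add: mult_2 power_add)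
  finally have "real (card ?J) \<le> real ((n + 1) ^ (2 * s))" by (rule of_nat_mono)
  then have cardJ: "real (card ?J) \<le> (real n + 1) ^ (2 * s)" by (simp only: of_nat_power of_nat_add of_nat_1)
  have "{f. \<not> extendable n s f} \<subseteq> (\<Union>j\<in>?J. ?X j)"
  proof
    fix f assume "f \<in> {f. \<not> extendable n s f}"
    then obtain A B where AB: "A \<subseteq> {..<n}" "B \<subseteq> {..<n}" "A \<inter> B = {}" "card (A \<union> B) \<le> s"
      "f \<in> ?X (A, B)"
      unfolding extendable_def by auto
    have "card A \<le> card (A \<union> B)" "card B \<le> card (A \<union> B)"
      using AB(1,2) finite_subset[of _ "{..<n}"] by (auto intro!: card_mono)
    then have "(A, B) \<in> ?J" using AB by auto
    then show "f \<in> (\<Union>j\<in>?J. ?X j)" using AB(5) by (rule UN_I)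
  qed
  then have "measure_pmf.prob (edge_pmf n p) {f. \<not> extendable n s f}
      \<le> measure_pmf.prob (edge_pmf n p) (\<Union>j\<in>?J. ?X j)"
    by (intro measure_pmf.finite_measure_mono) auto
  also have "\<dots> \<le> (\<Sum>j\<in>?J. measure_pmf.prob (edge_pmf n p) (?X j))"
    by (intro measure_pmf.finite_measure_subadditive_finite finJ) auto
  also have "\<dots> \<le> (\<Sum>j\<in>?J. ?c)"
  proof (rule sum_mono)
    fix j assume "j \<in> ?J"
    then obtain A B where "j = (A, B)" "A \<subseteq> {..<n}" "B \<subseteq> {..<n}" "A \<inter> B = {}" "card (A \<union> B) \<le> s"
      by blast
    then show "measure_pmf.prob (edge_pmf n p) (?X j) \<le> ?c"
      using prob_no_witness_le[OF p, of A n B s] by simp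
  qed
  also have "\<dots> \<le> (real n + 1) ^ (2 * s) * ?c"
    using mult_right_mono[OF cardJ c] by simp
  finally show ?thesis .
qed

section \<open>Combining the bad events and passing to the limit\<close>

text \<open>The three error terms bound the bad events: more than \<open>s\<close> ordered near
  pairs (\<open>H1\<close>), two near pairs sharing a vertex (\<open>H2\<close>), and failure of the
  extension property (\<open>H3\<close>).\<close>

lemma prob_multiset_chromatic_number_ge:
  fixes p :: real
  assumes p: "0 < p" "p < 1" and n: "22 \<le> n"
  defines "K \<equiv> 64 / (p * (1 - p))\<^sup>2"
  shows "measure_pmf.prob (gnp n p) {E. multiset_chromatic_number {..<n} E \<le> 4} \<ge>
    1 - (3 * K / real (Suc s) + 9 * K\<^sup>2 / real n
      + (real n + 1) ^ (2 * s) * (1 - min p (1 - p) ^ s) ^ (n div 4 - s))"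
proof -
  let ?M = "edge_pmf n p" and ?P = "\<lambda>X. measure_pmf.prob (edge_pmf n p) X"
  define b4 where "b4 = (1 / sqrt (real (Suc (n div 4 - 3)) * p * (1 - p))) ^ 4"
  have b4: "b4 \<le> K / (real n)\<^sup>2" "0 \<le> b4"
  proof -
    define X where "X = real (Suc (n div 4 - 3)) * p * (1 - p)"
    \<comment> \<open>Since \<open>n div 4\<close> is at least \<open>(n - 3) / 4\<close>, it
      suffices that \<open>(n - 3) / 4 - 2\<close> is at least \<open>n / 8\<close>, which is
      \<open>22 \<le> n\<close>. Squaring the 8 gives the 64 in \<open>K\<close>.\<close>
    have "real n / 8 \<le> real (Suc (n div 4 - 3))" using n by linarith
    then have X: "real n / 8 * (p * (1 - p)) \<le> X"
      unfolding X_def mult.assoc using p by (intro mult_right_mono) auto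
    have pos: "0 < real n / 8 * (p * (1 - p))" using p n by simp
    then have "0 < X" using X by linarith
    then have "sqrt X ^ 4 = X\<^sup>2"
      using power_mult[of "sqrt X" 2 2] by simp
    then have "b4 = 1 / X\<^sup>2" unfolding b4_def X_def[symmetric] by (simp add: power_divide)
    also have "\<dots> \<le> 1 / (real n / 8 * (p * (1 - p)))\<^sup>2"
      using X pos \<open>0 < X\<close> p n by (intro divide_left_mono power_mono mult_pos_pos zero_less_power) auto
    also have "\<dots> = K / (real n)\<^sup>2" by (simp add: K_def power_mult_distrib power_divide)
    finally show "b4 \<le> K / (real n)\<^sup>2" .
    show "0 \<le> b4" by (simp add: b4_def)
  qed
  define J2 where "J2 = {(u, v) \<in> {..<n} \<times> {..<n}. u \<noteq> v}"
  define J3 where "J3 = {(u, w, v) \<in> {..<n} \<times> {..<n} \<times> {..<n}. u \<noteq> w \<and> u \<noteq> v \<and> w \<noteq> v}"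
  define A2 where "A2 = (\<lambda>(u, v). {f. near n f u v})"
  define A3 where "A3 = (\<lambda>(u, w, v). {f. near n f u v \<and> near n f w v})"
  define H1 where "H1 = {f. Suc s \<le> card {j \<in> J2. f \<in> A2 j}}"
  define H2 where "H2 = (\<Union>j\<in>J3. A3 j)"
  define H3 where "H3 = {f. \<not> extendable n s f}"
  have J2: "J2 \<subseteq> {..<n} \<times> {..<n}" "finite J2" and J3: "J3 \<subseteq> {..<n} \<times> {..<n} \<times> {..<n}" "finite J3"
    by (auto simp: J2_def J3_def intro: finite_subset[of _ "{..<n} \<times> {..<n}"]
        finite_subset[of _ "{..<n} \<times> {..<n} \<times> {..<n}"])
  have "card J2 \<le> n * n" "card J3 \<le> n * (n * n)"
    using card_mono[OF _ J2(1)] card_mono[OF _ J3(1)] by (simp_all add: card_cartesian_product)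
  then have "real (card J2) \<le> real (n * n)" "real (card J3) \<le> real (n * (n * n))"
    by (simp_all only: of_nat_le_iff)
  then have cards: "real (card J2) \<le> (real n)\<^sup>2" "real (card J3) \<le> (real n) ^ 3"
    by (simp_all add: power2_eq_square power3_eq_cube)
  have "real (Suc s) * ?P H1 \<le> (\<Sum>j\<in>J2. ?P (A2 j))"
    unfolding H1_def by (rule prob_card_events_le[OF J2(2)])
  also have "\<dots> \<le> (\<Sum>j\<in>J2. 3 * b4)"
  proof (rule sum_mono)
    fix j assume "j \<in> J2"
    then obtain u v where j: "j = (u, v)" "u < n" "v < n" "u \<noteq> v" by (auto simp: J2_def)
    then show "?P (A2 j) \<le> 3 * b4"
      using prob_near_le[OF p, of "{u}" n v] by (simp add: A2_def b4_def)
  qed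
  also have "\<dots> \<le> (real n)\<^sup>2 * (3 * (K / (real n)\<^sup>2))"
    using cards(1) b4 by (simp only: sum_constant) (intro mult_mono, auto)
  also have "\<dots> = 3 * K" using n by simp
  finally have H1: "?P H1 \<le> 3 * K / real (Suc s)" by (simp add: field_simps)
  have "?P H2 \<le> (\<Sum>j\<in>J3. ?P (A3 j))"
    unfolding H2_def by (intro measure_pmf.finite_measure_subadditive_finite J3) auto
  also have "\<dots> \<le> (\<Sum>j\<in>J3. (3 * b4)\<^sup>2)"
  proof (rule sum_mono)
    fix j assume "j \<in> J3"
    then obtain u w v where j: "j = (u, w, v)" "u < n" "w < n" "v < n" "u \<noteq> w" "u \<noteq> v" "w \<noteq> v"
      by (auto simp: J3_def)
    then show "?P (A3 j) \<le> (3 * b4)\<^sup>2"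
      using prob_near_le[OF p, of "{u, w}" n v] by (simp add: A3_def b4_def)
  qed
  also have "\<dots> \<le> (real n) ^ 3 * (3 * (K / (real n)\<^sup>2))\<^sup>2"
    using cards(2) b4 by (simp only: sum_constant) (intro mult_mono power_mono, auto)
  also have "\<dots> = 9 * K\<^sup>2 / real n"
    using n by (simp add: power_mult_distrib power_divide field_simps power2_eq_square power3_eq_cube)
  finally have H2: "?P H2 \<le> 9 * K\<^sup>2 / real n" .
  have H3: "?P H3 \<le> (real n + 1) ^ (2 * s) * (1 - min p (1 - p) ^ s) ^ (n div 4 - s)"
    unfolding H3_def by (rule prob_not_extendable_le[OF p])
  define good where "good = {f. multiset_chromatic_number {..<n} {e \<in> nsets {..<n} 2. f e} \<le> 4}"
  have "- good \<subseteq> H1 \<union> H2 \<union> H3"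
  proof
    fix f assume f: "f \<in> - good"
    show "f \<in> H1 \<union> H2 \<union> H3"
    proof (rule ccontr)
      assume not_H: "f \<notin> H1 \<union> H2 \<union> H3"
      have uniq: "u = w" if "near n f u v" "near n f w v" for u v w
      proof (rule ccontr)
        assume "u \<noteq> w"
        then have "(u, w, v) \<in> J3" using that by (auto simp: J3_def near_def)
        then have "f \<in> H2" using that unfolding H2_def by (intro UN_I) (auto simp: A3_def)
        then show False using not_H by simp
      qed
      \<comment> \<open>Every vertex of a near pair is the first entry of an ordered near pair, so
        the bound on ordered pairs also bounds these vertices.\<close>
      have "{u. \<exists>v. near n f u v} = fst ` {j \<in> J2. f \<in> A2 j}"
        by (force simp: J2_def A2_def near_def)
      then have "card {u. \<exists>v. near n f u v} \<le> card {j \<in> J2. f \<in> A2 j}"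
        using J2(2) card_image_le[of "{j \<in> J2. f \<in> A2 j}" fst] by simp
      also have "\<dots> \<le> s" using not_H by (simp add: H1_def)
      finally have few: "card {u. \<exists>v. near n f u v} \<le> s" .
      have "extendable n s f" using not_H by (simp add: H3_def)
      then show False
        using multiset_chromatic_number_le_4[of n f s] n uniq few f by (simp add: good_def)
    qed
  qed
  then have "?P (- good) \<le> ?P (H1 \<union> H2 \<union> H3)"
    by (intro measure_pmf.finite_measure_mono) auto
  also have "\<dots> \<le> ?P H1 + ?P H2 + ?P H3"
    using measure_Un_le[of "H1 \<union> H2" ?M H3] measure_Un_le[of H1 ?M H2] by simp
  finally have "?P (- good) \<le> ?P H1 + ?P H2 + ?P H3" .
  moreover have "?P (- good) = 1 - ?P good"
    using measure_pmf.prob_compl[of good ?M] by (simp add: Compl_eq_Diff_UNIV)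
  moreover have "measure_pmf.prob (gnp n p) {E. multiset_chromatic_number {..<n} E \<le> 4} = ?P good"
    by (simp add: gnp_def good_def vimage_def)
  ultimately show ?thesis using H1 H2 H3 by linarith
qed

theorem theorem2p6:
  fixes p :: real
  assumes "0 < p" and "p < 1"
  shows "(\<lambda>n. measure_pmf.prob (gnp n p)
            {E. multiset_chromatic_number {..<n} E \<le> 4}) \<longlonglongrightarrow> 1"
proof (rule LIMSEQ_I)
  fix \<epsilon> :: real assume \<epsilon>: "0 < \<epsilon>"
  let ?P = "\<lambda>n. measure_pmf.prob (gnp n p) {E. multiset_chromatic_number {..<n} E \<le> 4}"
  define K where "K = 64 / (p * (1 - p))\<^sup>2"
  have K: "0 \<le> K" by (simp add: K_def)
  \<comment> \<open>The Markov term does not depend on \<open>n\<close>, so \<open>s\<close> is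
    fixed first to make it less than \<open>\<epsilon> / 2\<close>; the other two terms then vanish
    as \<open>n\<close> grows.\<close>
  obtain s :: nat where s: "6 * K / \<epsilon> < real s"
    using reals_Archimedean2 by blast
  moreover have "0 \<le> 6 * K / \<epsilon>" using K \<epsilon> by simp
  ultimately have "0 < real s" by linarith
  then have "0 < s" by simp
  \<comment> \<open>Positivity of \<open>s\<close> keeps \<open>c\<close> above 0 and the exponent
    \<open>2 * s\<close> nonzero, as the limit lemma requires.\<close>
  define c where "c = 1 - min p (1 - p) ^ s"
  have c: "0 < c" "c < 1"
    using assms \<open>0 < s\<close> by (auto simp: c_def power_less_one_iff)
  have "6 * K < real s * \<epsilon>" using s \<epsilon> by (simp add: field_simps)
  then have "6 * K < real (Suc s) * \<epsilon>" using \<epsilon> by (simp add: algebra_simps)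
  then have s_bound: "3 * K / real (Suc s) < \<epsilon> / 2" by (simp add: field_simps)
  have "(\<lambda>n. 9 * K\<^sup>2 / real n + (real n + 1) ^ (2 * s) * c ^ (n div 4 - s)) \<longlonglongrightarrow> 0 + 0"
    using c \<open>0 < s\<close> by (intro tendsto_add lim_const_over_n poly_times_exponential_tendsto_0) auto
  then have "\<forall>\<^sub>F n in sequentially. 9 * K\<^sup>2 / real n + (real n + 1) ^ (2 * s) * c ^ (n div 4 - s) < \<epsilon> / 2"
    using \<epsilon> by (intro order_tendstoD(2)[where y = "0 + 0"]) auto
  then have "\<forall>\<^sub>F n in sequentially. norm (?P n - 1) < \<epsilon>"
    using eventually_ge_at_top[of 22]
  proof eventually_elim
    case (elim n)
    have "1 - \<epsilon> < ?P n"
      using prob_multiset_chromatic_number_ge[OF assms elim(2), of s] elim(1) s_bound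
      by (simp only: K_def[symmetric] c_def[symmetric])
    moreover have "?P n \<le> 1" by simp
    ultimately show ?case using \<epsilon> unfolding real_norm_def by linarith
  qed
  then show "\<exists>N. \<forall>n\<ge>N. norm (?P n - 1) < \<epsilon>"
    by (simp add: eventually_sequentially)
qed

end
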